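(* Let $n\ge 2$, $m\ge 2$, and let $\mathcal{A}=(a_{i_1\cdots i_m})\in\mathbb{R}^{[m,n]}$. Then $$\Omega(\mathcal{A})\subseteq\Psi(\mathcal{A})\subseteq\mathcal{L}(\mathcal{A})\subseteq\mathcal{K}(\mathcal{A}),$$ where the four subsets $\Omega(\mathcal{A}),\Psi(\mathcal{A}),\mathcal{L}(\mathcal{A}),\mathcal{K}(\mathcal{A})$ of $\mathbb{C}$ are as defined in the context.
   Context: $\mathbb{R}^{[m,n]}$ denotes the set of real tensors of order $m$ and dimension $n$, i.e. arrays $\mathcal{A}=(a_{i_1i_2\cdots i_m})$ with $a_{i_1\cdots i_m}\in\mathbb{R}$ for all $i_1,\dots,i_m\in N=\{1,\dots,n\}$. For $i,j\in N$, $$R_i(\mathcal{A})=\sum_{i_2,\dots,i_m\in N}|a_{ii_2\cdots i_m}|,\qquad r_i^{\Delta_j}(\mathcal{A})=\sum_{j\in\{i_2,\dots,i_m\}}|a_{ii_2\cdots i_m}|,\qquad r_i^{\overline{\Delta}_j}(\mathcal{A})=\sum_{j\notin\{i_2,\dots,i_m\}}|a_{ii_2\cdots i_m}|,$$ where the last two sums run over all tuples $(i_2,\dots,i_m)\in N^{m-1}$ such that $j$ does, respectively does not, occur among $i_2,\dots,i_m$ (in particular $r_j^{\Delta_j}$ and $r_j^{\overline{\Delta}_j}$ are these quantities with first index equal to $j$). The entry $a_{ij\cdots j}$ has first index $i$ and all other $m-1$ indices equal to $j$. The sets are: $\mathcal{K}(\mathcal{A})=\bigcup_{i\in N}\mathcal{K}_i(\mathcal{A})$,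 with $\mathcal{K}_i(\mathcal{A})=\{z\in\mathbb{C}:|z|\le R_i(\mathcal{A})\}$. $\mathcal{L}(\mathcal{A})=\bigcup_{i\in N}\bigcap_{j\in N,\,j\ne i}\mathcal{L}_{i,j}(\mathcal{A})$, with $$\mathcal{L}_{i,j}(\mathcal{A})=\left\{z\in\mathbb{C}:\big(|z|-(R_i(\mathcal{A})-|a_{ij\cdots j}|)\big)|z|\le |a_{ij\cdots j}|R_j(\mathcal{A})\right\}.$$ $\Psi(\mathcal{A})=\bigcup_{i\in N}\bigcap_{j\in N,\,j\ne i}\Psi_{i,j}(\mathcal{A})$, with $$\Psi_{i,j}(\mathcal{A})=\left\{z\in\mathbb{C}:\big(|z|-r_i^{\overline{\Delta}_j}(\mathcal{A})\big)|z|\le r_i^{\Delta_j}(\mathcal{A})R_j(\mathcal{A})\right\}.$$ $$\Omega(\mathcal{A})=\left(\bigcup_{i\in N}\bigcap_{j\in N,\, j\neq i}\hat{\Omega}_{i,j}(\mathcal{A})\right)\bigcup\left(\bigcup_{i\in N}\bigcap_{j\in N,\, j\neq i}\Big(\tilde{\Omega}_{i,j}(\mathcal{A})\cap \mathcal{K}_i(\mathcal{A})\Big)\right),$$ with $$\hat{\Omega}_{i,j}(\mathcal{A})=\left\{z\in\mathbb{C}: |z|<r_i^{\overline{\Delta}_j}(\mathcal{A}),\ |z|<r_j^{\Delta_j}(\mathcal{A})\right\},$$ $$\tilde{\Omega}_{i,j}(\mathcal{A})=\left\{z\in\mathbb{C}: \big(|z|-r_i^{\overline{\Delta}_j}(\mathcal{A})\big)\big(|z|-r_j^{\Delta_j}(\mathcal{A})\big)\le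 r_i^{\Delta_j}(\mathcal{A})\,r_j^{\overline{\Delta}_j}(\mathcal{A})\right\}.$$ *)

theory Defs
  imports Complex_Main "HOL-Library.FuncSet"
begin

text \<open>An index tuple \<open>(i\<^sub>1, \<dots>, i\<^sub>k)\<close> over \<open>N = {1, \<dots>, n}\<close> is a list of length \<open>k\<close> with entries in \<open>{1..n}\<close>.\<close>

definition index_tuples :: "nat \<Rightarrow> nat \<Rightarrow> nat list set" where
  "index_tuples k n = {is. length is = k \<and> set is \<subseteq> {1..n}}"

text \<open>Arrays are extensional, so tensors of order \<open>m\<close> and dimension \<open>n\<close> correspond one-to-one to
  the members of \<open>tensors m n\<close>. In every definition below \<open>m\<close> is the order and \<open>n\<close> the dimension.\<close>

definition tensors :: "nat \<Rightarrow> nat \<Rightarrow> (nat list \<Rightarrow> real) set" where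
  "tensors m n = index_tuples m n \<rightarrow>\<^sub>E UNIV"

definition row_sum :: "nat \<Rightarrow> nat \<Rightarrow> (nat list \<Rightarrow> real) \<Rightarrow> nat \<Rightarrow> real" where
  "row_sum m n A i = (\<Sum>is \<in> index_tuples (m - 1) n. \<bar>A (i # is)\<bar>)"

text \<open>\<open>row_sum_with m n A i j\<close> and \<open>row_sum_without m n A i j\<close> are
  \<open>r\<^sub>i\<close> with superscript \<open>\<Delta>\<^sub>j\<close> and overlined \<open>\<Delta>\<^sub>j\<close>, respectively.\<close>

definition row_sum_with :: "nat \<Rightarrow> nat \<Rightarrow> (nat list \<Rightarrow> real) \<Rightarrow> nat \<Rightarrow> nat \<Rightarrow> real" where
  "row_sum_with m n A i j = (\<Sum>is \<in> {is \<in> index_tuples (m - 1) n. j \<in> set is}. \<bar>A (i # is)\<bar>)"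

definition row_sum_without :: "nat \<Rightarrow> nat \<Rightarrow> (nat list \<Rightarrow> real) \<Rightarrow> nat \<Rightarrow> nat \<Rightarrow> real" where
  "row_sum_without m n A i j = (\<Sum>is \<in> {is \<in> index_tuples (m - 1) n. j \<notin> set is}. \<bar>A (i # is)\<bar>)"

text \<open>The entry \<open>a\<close> with first index \<open>i\<close> and the other \<open>m - 1\<close> indices equal to \<open>j\<close>.\<close>

definition row_entry :: "nat \<Rightarrow> (nat list \<Rightarrow> real) \<Rightarrow> nat \<Rightarrow> nat \<Rightarrow> real" where
  "row_entry m A i j = A (i # replicate (m - 1) j)"

definition K_comp :: "nat \<Rightarrow> nat \<Rightarrow> (nat list \<Rightarrow> real) \<Rightarrow> nat \<Rightarrow> complex set" where
  "K_comp m n A i = {z. cmod z \<le> row_sum m n A i}"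

definition K_set :: "nat \<Rightarrow> nat \<Rightarrow> (nat list \<Rightarrow> real) \<Rightarrow> complex set" where
  "K_set m n A = (\<Union>i\<in>{1..n}. K_comp m n A i)"

definition L_comp :: "nat \<Rightarrow> nat \<Rightarrow> (nat list \<Rightarrow> real) \<Rightarrow> nat \<Rightarrow> nat \<Rightarrow> complex set" where
  "L_comp m n A i j =
    {z. (cmod z - (row_sum m n A i - \<bar>row_entry m A i j\<bar>)) * cmod z
          \<le> \<bar>row_entry m A i j\<bar> * row_sum m n A j}"

definition L_set :: "nat \<Rightarrow> nat \<Rightarrow> (nat list \<Rightarrow> real) \<Rightarrow> complex set" where
  "L_set m n A = (\<Union>i\<in>{1..n}. \<Inter>j\<in>{1..n} - {i}. L_comp m n A i j)"

definition Psi_comp :: "nat \<Rightarrow> nat \<Rightarrow> (nat list \<Rightarrow> real) \<Rightarrow> nat \<Rightarrow> nat \<Rightarrow> complex set" where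
  "Psi_comp m n A i j =
    {z. (cmod z - row_sum_without m n A i j) * cmod z
          \<le> row_sum_with m n A i j * row_sum m n A j}"

definition Psi_set :: "nat \<Rightarrow> nat \<Rightarrow> (nat list \<Rightarrow> real) \<Rightarrow> complex set" where
  "Psi_set m n A = (\<Union>i\<in>{1..n}. \<Inter>j\<in>{1..n} - {i}. Psi_comp m n A i j)"

definition Omega_hat :: "nat \<Rightarrow> nat \<Rightarrow> (nat list \<Rightarrow> real) \<Rightarrow> nat \<Rightarrow> nat \<Rightarrow> complex set" where
  "Omega_hat m n A i j =
    {z. cmod z < row_sum_without m n A i j \<and> cmod z < row_sum_with m n A j j}"

definition Omega_tilde :: "nat \<Rightarrow> nat \<Rightarrow> (nat list \<Rightarrow> real) \<Rightarrow> nat \<Rightarrow> nat \<Rightarrow> complex set" where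
  "Omega_tilde m n A i j =
    {z. (cmod z - row_sum_without m n A i j) * (cmod z - row_sum_with m n A j j)
          \<le> row_sum_with m n A i j * row_sum_without m n A j j}"

definition Omega_set :: "nat \<Rightarrow> nat \<Rightarrow> (nat list \<Rightarrow> real) \<Rightarrow> complex set" where
  "Omega_set m n A =
    (\<Union>i\<in>{1..n}. \<Inter>j\<in>{1..n} - {i}. Omega_hat m n A i j) \<union>
    (\<Union>i\<in>{1..n}. \<Inter>j\<in>{1..n} - {i}. Omega_tilde m n A i j \<inter> K_comp m n A i)"

end

theory Submission imports Defs begin

text \<open>Write \<open>t = |z|\<close> and split \<open>R\<^sub>i\<close> into its parts with and without index \<open>j\<close>. Only the
  inclusion of \<open>\<Psi>\<close> in \<open>L\<close> is not pointwise in \<open>i\<close>: if \<open>z\<close> lies in \<open>\<Psi>\<^sub>i\<^sub>,\<^sub>j\<close> for all \<open>j \<noteq> i\<close>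
  and \<open>t \<le> R\<^sub>i\<close>, then \<open>z\<close> lies in every \<open>L\<^sub>i\<^sub>,\<^sub>j\<close>. Otherwise \<open>t > R\<^sub>i\<close>, which forces \<open>t \<le> R\<^sub>j\<close> and
  \<open>t\<^sup>2 \<le> R\<^sub>i R\<^sub>j\<close> for all \<open>j \<noteq> i\<close>, and then \<open>z\<close> lies in every \<open>L\<^sub>k\<^sub>,\<^sub>j\<close> for an arbitrary \<open>k \<noteq> i\<close>.\<close>

lemma finite_index_tuples: "finite (index_tuples k n)"
  using finite_lists_length_eq[of "{1..n}" k] by (simp add: index_tuples_def conj_commute)

lemma row_sum_split: "row_sum m n A i = row_sum_with m n A i j + row_sum_without m n A i j"
  unfolding row_sum_def row_sum_with_def row_sum_without_def
  using sum.Int_Diff[OF finite_index_tuples, of "\<lambda>is. \<bar>A (i # is)\<bar>" "m - 1" n "{is. j \<in> set is}"]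
  by (simp add: Int_def Diff_eq)

lemma row_sum_with_nonneg: "row_sum_with m n A i j \<ge> 0"
  by (simp add: row_sum_with_def sum_nonneg)

lemma row_sum_without_nonneg: "row_sum_without m n A i j \<ge> 0"
  by (simp add: row_sum_without_def sum_nonneg)

lemma row_sum_nonneg: "row_sum m n A i \<ge> 0"
  by (simp add: row_sum_def sum_nonneg)

text \<open>For m \<ge> 2 the tuple \<open>replicate (m - 1) j\<close> is nonempty, so j occurs in
  it and its entry is one of the nonnegative summands.\<close>

lemma row_entry_le_row_sum_with:
  assumes "m \<ge> 2" "j \<in> {1..n}"
  shows "\<bar>row_entry m A i j\<bar> \<le> row_sum_with m n A i j"
  unfolding row_sum_with_def row_entry_def
  by (rule member_le_sum[where f = "\<lambda>is. \<bar>A (i # is)\<bar>"])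
    (use assms in \<open>auto simp: finite_index_tuples\<close>, auto simp: index_tuples_def)

lemma Omega_hat_subset_Psi_comp: "Omega_hat m n A i j \<subseteq> Psi_comp m n A i j"
proof
  fix z assume "z \<in> Omega_hat m n A i j"
  then have "(cmod z - row_sum_without m n A i j) * cmod z \<le> 0"
    by (simp add: Omega_hat_def mult_nonpos_nonneg)
  also have "0 \<le> row_sum_with m n A i j * row_sum m n A j"
    by (simp add: row_sum_with_nonneg row_sum_nonneg)
  finally show "z \<in> Psi_comp m n A i j"
    by (simp add: Psi_comp_def)
qed

text \<open>Membership in \<open>K_comp\<close> gives \<open>?t - ?b \<le> ?a\<close>, so (t - b) t
  = (t - b)(t - c) + (t - b) c is at most a d + a c = a R_j.\<close>

lemma Omega_tilde_subset_Psi_comp: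
  "Omega_tilde m n A i j \<inter> K_comp m n A i \<subseteq> Psi_comp m n A i j"
proof
  fix z assume z: "z \<in> Omega_tilde m n A i j \<inter> K_comp m n A i"
  let ?t = "cmod z" and ?a = "row_sum_with m n A i j" and ?b = "row_sum_without m n A i j"
    and ?c = "row_sum_with m n A j j" and ?d = "row_sum_without m n A j j"
  have "?t - ?b \<le> ?a"
    using z row_sum_split[of m n A i j] by (simp add: K_comp_def)
  then have "(?t - ?b) * ?c \<le> ?a * ?c"
    by (simp add: mult_right_mono row_sum_with_nonneg)
  moreover have "(?t - ?b) * (?t - ?c) \<le> ?a * ?d"
    using z by (simp add: Omega_tilde_def)
  ultimately show "z \<in> Psi_comp m n A i j"
    by (simp add: Psi_comp_def row_sum_split[of m n A j j] algebra_simps)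
qed

lemma Omega_set_subset_Psi_set: "Omega_set m n A \<subseteq> Psi_set m n A"
  unfolding Omega_set_def Psi_set_def
  by (intro Un_least UN_mono INF_mono' Omega_hat_subset_Psi_comp Omega_tilde_subset_Psi_comp subset_refl)

lemma L_compI_le:
  assumes "cmod z \<le> row_sum m n A i" "cmod z \<le> row_sum m n A j"
  shows "z \<in> L_comp m n A i j"
proof -
  let ?e = "\<bar>row_entry m A i j\<bar>"
  have "(cmod z - (row_sum m n A i - ?e)) * cmod z \<le> ?e * cmod z"
    using assms by (intro mult_right_mono) auto
  also have "\<dots> \<le> ?e * row_sum m n A j"
    using assms by (intro mult_left_mono) auto
  finally show ?thesis by (simp add: L_comp_def)
qed

lemma Psi_comp_imp_L_comp:
  assumes "m \<ge> 2" "j \<in> {1..n}" "z \<in> Psi_comp m n A i j" "cmod z \<le> row_sum m n A i"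
  shows "z \<in> L_comp m n A i j"
proof (cases "cmod z \<le> row_sum m n A j")
  case True
  with assms show ?thesis by (intro L_compI_le)
next
  case False
  let ?a = "row_sum_with m n A i j" and ?e = "\<bar>row_entry m A i j\<bar>"
  \<comment> \<open>Since R_i - e = b + (a - e), subtracting this from the \<open>Psi_comp\<close>
    inequality (t - b) t \<le> a R_j yields the one for \<open>L_comp\<close>.\<close>
  have "(?a - ?e) * row_sum m n A j \<le> (?a - ?e) * cmod z"
    using False row_entry_le_row_sum_with[OF assms(1,2)] by (intro mult_left_mono) auto
  then show ?thesis
    using assms(3) by (simp add: Psi_comp_def L_comp_def row_sum_split[of m n A i j] algebra_simps)
qed

text \<open>From t > R_i follows t - b > a, so t > R_j would give (t - b) t > a t \<ge> a
  R_j.\<close>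

lemma Psi_comp_le_row_sum:
  assumes "z \<in> Psi_comp m n A i j" "cmod z > row_sum m n A i"
  shows "cmod z \<le> row_sum m n A j"
proof (rule ccontr)
  let ?t = "cmod z" and ?a = "row_sum_with m n A i j" and ?b = "row_sum_without m n A i j"
  assume "\<not> ?t \<le> row_sum m n A j"
  then have "?a * row_sum m n A j \<le> ?a * ?t"
    by (intro mult_left_mono) (auto simp: row_sum_with_nonneg)
  moreover have "?a * ?t < (?t - ?b) * ?t"
  proof (rule mult_strict_right_mono)
    show "?a < ?t - ?b" using assms(2) row_sum_split[of m n A i j] by simp
    show "0 < ?t" using assms(2) row_sum_nonneg[of m n A i] by linarith
  qed
  ultimately show False using assms(1) by (simp add: Psi_comp_def)
qed

text \<open>Here t^2 \<le> b t + a R_j \<le> (b + a) R_j. The bound is symmetric in i and j, so it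
  can be reused with the indices swapped.\<close>

lemma Psi_comp_power2_le:
  assumes "z \<in> Psi_comp m n A i j" "cmod z \<le> row_sum m n A j"
  shows "(cmod z)\<^sup>2 \<le> row_sum m n A i * row_sum m n A j"
proof -
  have "row_sum_without m n A i j * cmod z \<le> row_sum_without m n A i j * row_sum m n A j"
    using assms(2) by (simp add: mult_left_mono row_sum_without_nonneg)
  then show ?thesis
    using assms(1)
    by (simp add: Psi_comp_def row_sum_split[of m n A i j] power2_eq_square algebra_simps)
qed

text \<open>The expression t^2 - R_i t + e (t - R_j) must be nonpositive. Replacing t^2 by R_i R_j
  and e by R_i can only increase it, and then it vanishes.\<close>

lemma L_compI_power2:
  assumes "m \<ge> 2" "j \<in> {1..n}"
    and "row_sum m n A j \<le> cmod z" "(cmod z)\<^sup>2 \<le> row_sum m n A i * row_sum m n A j"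
  shows "z \<in> L_comp m n A i j"
proof -
  let ?t = "cmod z" and ?e = "\<bar>row_entry m A i j\<bar>"
  have "?e \<le> row_sum m n A i"
    using row_entry_le_row_sum_with[OF assms(1,2), of A i] row_sum_split[of m n A i j]
      row_sum_without_nonneg[of m n A i j] by linarith
  then have "?e * (?t - row_sum m n A j) \<le> row_sum m n A i * (?t - row_sum m n A j)"
    using assms(3) by (simp add: mult_right_mono)
  then show ?thesis
    using assms(4) by (simp add: L_comp_def power2_eq_square algebra_simps)
qed

text \<open>Ensures that the intersections over j \<noteq> i do not range over an empty family,
  which would make them the whole plane.\<close>

lemma ex_other_index:
  fixes n i :: nat
  assumes "n \<ge> 2"
  obtains k where "k \<in> {1..n} - {i}"
proof (cases "i = 1")
  case True
  with assms that[of 2] show ?thesis by simp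
next
  case False
  with assms that[of 1] show ?thesis by simp
qed

lemma Psi_set_subset_L_set:
  assumes "n \<ge> 2" "m \<ge> 2"
  shows "Psi_set m n A \<subseteq> L_set m n A"
proof
  fix z assume "z \<in> Psi_set m n A"
  then obtain i where i: "i \<in> {1..n}"
    and Psi: "\<And>j. j \<in> {1..n} - {i} \<Longrightarrow> z \<in> Psi_comp m n A i j"
    unfolding Psi_set_def by blast
  show "z \<in> L_set m n A"
  proof (cases "cmod z \<le> row_sum m n A i")
    case True
    then have "z \<in> L_comp m n A i j" if "j \<in> {1..n} - {i}" for j
      using Psi_comp_imp_L_comp[OF assms(2) _ Psi[OF that]] that by simp
    with i show ?thesis unfolding L_set_def by blast
  next
    case False
    then have le: "cmod z \<le> row_sum m n A j" if "j \<in> {1..n} - {i}" for j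
      using Psi_comp_le_row_sum[OF Psi[OF that]] False by simp
    obtain k where k: "k \<in> {1..n} - {i}"
      using ex_other_index assms(1) by blast
    have "z \<in> L_comp m n A k j" if j: "j \<in> {1..n} - {k}" for j
    \<comment> \<open>Only column i has R_j < t and needs the quadratic bound; for every other j
      both R_k and R_j are at least t.\<close>
    proof (cases "j = i")
      case True
      have "(cmod z)\<^sup>2 \<le> row_sum m n A k * row_sum m n A i"
        using Psi_comp_power2_le[OF Psi[OF k] le[OF k]] by (simp add: mult.commute)
      with False i assms(2) show ?thesis
        unfolding True by (intro L_compI_power2) auto
    next
      case False
      with j k show ?thesis by (intro L_compI_le le) auto
    qed
    with k show ?thesis unfolding L_set_def by blast
  qed
qed

text \<open>If t exceeded both row sums, adding (t - R_i) t > 0 and e t \<ge> e R_j would contradict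
  the defining inequality.\<close>

lemma L_comp_subset_K_comp: "L_comp m n A i j \<subseteq> K_comp m n A i \<union> K_comp m n A j"
proof (rule subsetI, rule ccontr)
  fix z assume L: "z \<in> L_comp m n A i j" and "z \<notin> K_comp m n A i \<union> K_comp m n A j"
  then have gt: "row_sum m n A i < cmod z" "row_sum m n A j < cmod z"
    by (auto simp: K_comp_def)
  let ?e = "\<bar>row_entry m A i j\<bar>"
  have "?e * row_sum m n A j \<le> ?e * cmod z"
    using gt by (intro mult_left_mono) auto
  moreover have "0 < (cmod z - row_sum m n A i) * cmod z"
    using gt row_sum_nonneg[of m n A i] by (intro mult_pos_pos) linarith+
  ultimately show False
    using L by (simp add: L_comp_def algebra_simps)
qed

lemma L_set_subset_K_set:
  assumes "n \<ge> 2"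
  shows "L_set m n A \<subseteq> K_set m n A"
proof
  fix z assume "z \<in> L_set m n A"
  then obtain i where i: "i \<in> {1..n}" and L: "\<And>j. j \<in> {1..n} - {i} \<Longrightarrow> z \<in> L_comp m n A i j"
    unfolding L_set_def by blast
  obtain j where j: "j \<in> {1..n} - {i}"
    using ex_other_index assms by blast
  have "z \<in> K_comp m n A i \<union> K_comp m n A j"
    using L_comp_subset_K_comp L[OF j] by blast
  with i j show "z \<in> K_set m n A"
    unfolding K_set_def by blast
qed

theorem theorem5:
  fixes m n :: nat and A :: "nat list \<Rightarrow> real"
  assumes "n \<ge> 2" and "m \<ge> 2" and "A \<in> tensors m n"
  shows "Omega_set m n A \<subseteq> Psi_set m n A \<and> Psi_set m n A \<subseteq> L_set m n A \<and> L_set m n A \<subseteq> K_set m n A"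
  using assms(1,2) by (intro conjI Omega_set_subset_Psi_set Psi_set_subset_L_set L_set_subset_K_set)

end
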